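(* The parameterized problem Total Edge Cover (parameter $k_d$) admits a kernel with at most $1.5k_d$ vertices.
   Context: For a graph $G=(V,E)$, an edge cover is a set $EC\subseteq E$ such that every vertex of $G$ is incident to an edge of $EC$; it is total if every connected component of the graph $(V,EC)$ restricted to the covered edges, i.e. of the subgraph formed by the edges of $EC$, has at least two edges. Total Edge Cover: given $G$ and an integer $k_d$, decide whether $G$ has a total edge cover of size at most $k_d$. A kernel with at most $f(k_d)$ vertices is a polynomial-time algorithm that maps any instance $(G,k_d)$ to an equivalent instance $(G',k_d')$ with $k_d'\le k_d$ and $|V(G')|\le f(k_d)$.
   Formalization: The vertex bound is stated as max(0, 1.5k_d): for negative integers k_d the literal bound 1.5k_d is negative and no graph meets it, so there the kernel must be the empty graph; the output parameter may be negative. *)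

theory Defs
  imports Complex_Main "HOL-Computational_Algebra.Polynomial"
begin

section \<open>Total edge covers\<close>

type_synonym 'a graph = "'a set \<times> 'a set set"

definition simple_graph :: "'a graph \<Rightarrow> bool" where
  "simple_graph G \<longleftrightarrow> finite (fst G) \<and> (\<forall>e\<in>snd G. e \<subseteq> fst G \<and> card e = 2)"

definition edge_cover :: "'a graph \<Rightarrow> 'a set set \<Rightarrow> bool" where
  "edge_cover G C \<longleftrightarrow> C \<subseteq> snd G \<and> (\<forall>v\<in>fst G. \<exists>e\<in>C. v \<in> e)"

definition connected_in :: "'a graph \<Rightarrow> ('a \<times> 'a) set" where
  "connected_in G = {(u, v). u \<in> fst G \<and> v \<in> fst G \<and> (u, v) \<in> {(a, b). {a, b} \<in> snd G}\<^sup>*}"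

definition components :: "'a graph \<Rightarrow> 'a graph set" where
  "components G = (\<lambda>W. (W, {e \<in> snd G. e \<subseteq> W})) ` (fst G // connected_in G)"

definition total_edge_cover :: "'a graph \<Rightarrow> 'a set set \<Rightarrow> bool" where
  "total_edge_cover G C \<longleftrightarrow>
     edge_cover G C \<and> (\<forall>H\<in>components (\<Union>C, C). card (snd H) \<ge> 2)"

definition Total_Edge_Cover :: "'a graph \<Rightarrow> int \<Rightarrow> bool" where
  "Total_Edge_Cover G k \<longleftrightarrow> (\<exists>C. total_edge_cover G C \<and> int (card C) \<le> k)"


section \<open>Polynomial time\<close>

text \<open>
  Deterministic multi-tape Turing machines with two-way infinite tapes. The states are
  \<open>0, \<dots>, states M\<close>, where \<open>0\<close> is initial and \<open>states M\<close> is the only halting state. The tape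
  symbols are \<open>0, \<dots>, symbols M - 1\<close>, where \<open>0\<close> is the blank and \<open>1\<close>, \<open>2\<close> stand for the bits
  \<^const>\<open>False\<close>, \<^const>\<open>True\<close>. The transition function receives the current state and the list
  of scanned symbols, and returns the new state together with a written symbol and a head move
  for each tape.
\<close>

datatype move = MoveLeft | Stay | MoveRight

record tm =
  tapes :: nat
  states :: nat
  symbols :: nat
  delta :: "nat \<Rightarrow> nat list \<Rightarrow> nat \<times> (nat \<times> move) list"

definition turing_machine :: "tm \<Rightarrow> bool" where
  "turing_machine M \<longleftrightarrow> tapes M \<ge> 1 \<and> symbols M \<ge> 3 \<and>
     (\<forall>q ss. q < states M \<and> length ss = tapes M \<and> set ss \<subseteq> {..<symbols M} \<longrightarrow>
        fst (delta M q ss) \<le> states M \<and>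
        length (snd (delta M q ss)) = tapes M \<and>
        fst ` set (snd (delta M q ss)) \<subseteq> {..<symbols M})"

type_synonym tape = "(int \<Rightarrow> nat) \<times> int"
type_synonym config = "nat \<times> tape list"

fun scan :: "tape \<Rightarrow> nat" where
  "scan (t, h) = t h"

fun shift :: "move \<Rightarrow> int \<Rightarrow> int" where
  "shift MoveLeft h = h - 1"
| "shift Stay h = h"
| "shift MoveRight h = h + 1"

fun act :: "nat \<times> move \<Rightarrow> tape \<Rightarrow> tape" where
  "act (s, m) (t, h) = (t(h := s), shift m h)"

fun step :: "tm \<Rightarrow> config \<Rightarrow> config" where
  "step M (q, ts) =
     (if q < states M
      then let (q', as) = delta M q (map scan ts) in (q', map2 act as ts)
      else (q, ts))"

definition word_tape :: "bool list \<Rightarrow> int \<Rightarrow> nat" where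
  "word_tape w i = (if 0 \<le> i \<and> i < int (length w) then (if w ! nat i then 2 else 1) else 0)"

definition initial :: "tm \<Rightarrow> bool list \<Rightarrow> config" where
  "initial M w = (0, (word_tape w, 0) # replicate (tapes M - 1) (\<lambda>_. 0, 0))"

text \<open>Input and output are both on the first tape.\<close>

definition outputs_within :: "tm \<Rightarrow> bool list \<Rightarrow> bool list \<Rightarrow> nat \<Rightarrow> bool" where
  "outputs_within M x y b \<longleftrightarrow>
     (\<exists>t\<le>b. \<exists>ts. (step M ^^ t) (initial M x) = (states M, ts) \<and> fst (hd ts) = word_tape y)"

definition polytime_on :: "'i set \<Rightarrow> ('i \<Rightarrow> bool list) \<Rightarrow> ('i \<Rightarrow> 'i) \<Rightarrow> bool" where
  "polytime_on I enc f \<longleftrightarrow>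
     (\<exists>M. turing_machine M \<and> (\<exists>p :: nat poly. \<forall>x\<in>I.
        outputs_within M (enc x) (enc (f x)) (poly p (length (enc x)))))"


section \<open>Kernels for graph problems\<close>

definition graph_instances :: "(nat graph \<times> int) set" where
  "graph_instances = {(G, k). simple_graph G \<and> (\<exists>n. fst G = {..<n})}"

fun bits :: "nat \<Rightarrow> bool list" where
  "bits n = (if n = 0 then [] else odd n # bits (n div 2))"

declare bits.simps [simp del]

text \<open>
  Sign bit and binary digits of the absolute value (least significant first); made
  self-delimiting by putting \<^const>\<open>True\<close> before each digit and \<^const>\<open>False\<close> at the end.
\<close>

definition encode_int :: "int \<Rightarrow> bool list" where
  "encode_int k = (k < 0) # concat (map (\<lambda>b. [True, b]) (bits (nat \<bar>k\<bar>))) @ [False]"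

text \<open>The number of vertices in unary, followed by the adjacency matrix row by row.\<close>

definition encode_graph :: "nat graph \<Rightarrow> bool list" where
  "encode_graph G =
     (let n = card (fst G)
      in replicate n True @ [False] @
         concat (map (\<lambda>i. map (\<lambda>j. {i, j} \<in> snd G) [0..<n]) [0..<n]))"

fun encode_instance :: "nat graph \<times> int \<Rightarrow> bool list" where
  "encode_instance (G, k) = encode_int k @ encode_graph G"

text \<open>
  The parameter ranges over all integers, also in the output: if \<open>f 0 = 0\<close>, a no-instance having
  \<open>k = 0\<close> may only be mapped to the empty graph, and for \<^const>\<open>Total_Edge_Cover\<close> that is a
  no-instance only with a negative parameter.
\<close>

definition admits_vertex_kernel :: "(nat graph \<Rightarrow> int \<Rightarrow> bool) \<Rightarrow> (int \<Rightarrow> real) \<Rightarrow> bool" where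
  "admits_vertex_kernel P f \<longleftrightarrow>
     (\<exists>K. polytime_on graph_instances encode_instance K \<and>
        (\<forall>G k G' k'. (G, k) \<in> graph_instances \<and> K (G, k) = (G', k') \<longrightarrow>
           (G', k') \<in> graph_instances \<and> (P G k \<longleftrightarrow> P G' k') \<and> k' \<le> k \<and>
           real (card (fst G')) \<le> f k))"

end

theory Submission
  imports Defs
begin

text \<open>
  A connected graph with \<open>m \<ge> 2\<close> edges has at most \<open>m + 1 \<le> 3 m / 2\<close> vertices. Summing over the
  components of a total edge cover of size at most \<open>k\<close>, a yes-instance has \<open>n \<le> 3 k / 2\<close> vertices.
  Hence instances violating this bound can be replaced by the empty graph with a negative
  parameter, and all others are left unchanged. As \<open>k\<close> is given in binary and \<open>n\<close> in unary,
  a Turing machine tests \<open>2 n \<le> 3 k\<close> by running through the digits of \<open>k\<close>, subtracting three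
  times the digit from a unary counter and halving it.
\<close>

section \<open>Size of total edge covers\<close>

lemma equiv_connected_in: "equiv V (connected_in (V, C))"
proof (rule equivI)
  show "connected_in (V, C) \<subseteq> V \<times> V"
    by (auto simp: connected_in_def)
  show "refl_on V (connected_in (V, C))"
    by (auto simp: refl_on_def connected_in_def)
  have "sym {(a, b). {a, b} \<in> C}"
    by (auto simp: sym_def insert_commute)
  then have "sym ({(a, b). {a, b} \<in> C}\<^sup>*)"
    by (rule sym_rtrancl)
  then show "sym (connected_in (V, C))"
    by (auto simp: sym_def connected_in_def)
  show "trans (connected_in (V, C))"
    by (auto simp: trans_def connected_in_def)
qed

text \<open>A breadth-first tree rooted at \<open>r\<close>: every other vertex of \<open>W\<close>
  has a predecessor strictly closer to \<open>r\<close>, and the edges to these predecessors are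
  pairwise distinct edges inside \<open>W\<close>.\<close>

lemma card_connected_component_le:
  assumes fin: "finite C" and V: "\<Union>C \<subseteq> V"
    and W: "W \<in> V // connected_in (V, C)"
  shows "card W \<le> Suc (card {e \<in> C. e \<subseteq> W})"
proof -
  define R where "R = {(a, b). {a, b} \<in> C}"
  from W obtain r where r: "r \<in> V" and Wr: "W = connected_in (V, C) `` {r}"
    by (auto elim: quotientE)
  have memW: "v \<in> W \<longleftrightarrow> v \<in> V \<and> (r, v) \<in> R\<^sup>*" for v
    using r by (auto simp: Wr connected_in_def R_def)
  define d where "d v = (LEAST n. (r, v) \<in> R ^^ n)" for v
  have "\<exists>p. p \<in> W \<and> {p, v} \<in> C \<and> d p < d v" if v: "v \<in> W - {r}" for v
  proof -
    have "\<exists>n. (r, v) \<in> R ^^ n"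
      using v memW by (auto dest: rtrancl_imp_relpow)
    then have dv: "(r, v) \<in> R ^^ d v"
      unfolding d_def by (rule LeastI_ex)
    then obtain m where m: "d v = Suc m"
      using v by (cases "d v") auto
    with dv obtain p where p: "(r, p) \<in> R ^^ m" "(p, v) \<in> R"
      by auto
    have "d p \<le> m"
      unfolding d_def using p(1) by (rule Least_le)
    moreover have "{p, v} \<in> C"
      using p(2) by (simp add: R_def)
    moreover have "p \<in> W"
      using memW p(1) \<open>{p, v} \<in> C\<close> V by (auto dest: relpow_imp_rtrancl)
    ultimately show ?thesis
      using m by auto
  qed
  then obtain p where p: "\<And>v. v \<in> W - {r} \<Longrightarrow> p v \<in> W \<and> {p v, v} \<in> C \<and> d (p v) < d v"
    by metis
  \<comment> \<open>\<open>v\<close> is the end of \<open>{p v, v}\<close> farther from \<open>r\<close>.\<close>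
  have "inj_on (\<lambda>v. {p v, v}) (W - {r})"
  proof (rule inj_onI)
    fix v w assume vw: "v \<in> W - {r}" "w \<in> W - {r}" "{p v, v} = {p w, w}"
    show "v = w"
    proof (rule ccontr)
      assume "v \<noteq> w"
      with vw(3) have "p v = w" "p w = v"
        by (auto simp: doubleton_eq_iff)
      with p[OF vw(1)] p[OF vw(2)] show False
        by simp
    qed
  qed
  moreover have "(\<lambda>v. {p v, v}) ` (W - {r}) \<subseteq> {e \<in> C. e \<subseteq> W}"
    using p by auto
  ultimately have "card (W - {r}) \<le> card {e \<in> C. e \<subseteq> W}"
    using fin by (intro card_inj_on_le) auto
  then show ?thesis
    by (simp add: card_Diff_singleton_if split: if_splits)
qed

lemma total_edge_cover_card_vertices:
  assumes G: "simple_graph G" and C: "total_edge_cover G C"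
  shows "2 * card (fst G) \<le> 3 * card C"
proof -
  have CG: "C \<subseteq> snd G" and cov: "fst G \<subseteq> \<Union>C"
    using C by (auto simp: total_edge_cover_def edge_cover_def)
  have finG: "finite (fst G)" and two: "\<And>e. e \<in> C \<Longrightarrow> e \<subseteq> fst G \<and> card e = 2"
    using G CG by (auto simp: simple_graph_def)
  \<comment> \<open>All vertices are covered, so the components formed by \<open>C\<close> partition
    the whole vertex set.\<close>
  have V: "\<Union>C = fst G"
    using cov two by blast
  have finC: "finite C"
    using two finG by (intro finite_subset[of C "Pow (fst G)"]) auto
  define Q where "Q = \<Union>C // connected_in (\<Union>C, C)"
  define E where "E W = {e \<in> C. e \<subseteq> W}" for W
  have eq: "equiv (\<Union>C) (connected_in (\<Union>C, C))"
    by (rule equiv_connected_in)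
  have UQ: "\<Union>Q = fst G"
    unfolding Q_def using Union_quotient[OF eq] V by simp
  have finQ: "finite Q" and finW: "\<And>W. W \<in> Q \<Longrightarrow> finite W"
    using UQ finG by (auto intro: finite_UnionD finite_subset)
  have disj: "W \<inter> W' = {}" if "W \<in> Q" "W' \<in> Q" "W \<noteq> W'" for W W'
    using quotient_disj[OF eq] that unfolding Q_def by blast
  have "2 * card W \<le> 3 * card (E W)" if W: "W \<in> Q" for W
  proof -
    have "card W \<le> Suc (card (E W))"
      unfolding E_def using card_connected_component_le[OF finC order_refl] W
      by (simp add: Q_def)
    moreover have "2 \<le> card (E W)"
      using C W by (auto simp: total_edge_cover_def components_def Q_def E_def)
    ultimately show ?thesis
      by simp
  qed
  then have "(\<Sum>W\<in>Q. 2 * card W) \<le> (\<Sum>W\<in>Q. 3 * card (E W))"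
    by (rule sum_mono)
  moreover have "card (fst G) = (\<Sum>W\<in>Q. card W)"
    unfolding UQ[symmetric] using disj finW
    by (intro card_Union_disjoint) (auto simp: pairwise_def disjnt_def)
  moreover have "(\<Sum>W\<in>Q. card (E W)) = card (\<Union>W\<in>Q. E W)"
  proof (rule card_UN_disjoint[symmetric])
    show "\<forall>W\<in>Q. \<forall>W'\<in>Q. W \<noteq> W' \<longrightarrow> E W \<inter> E W' = {}"
    proof (intro ballI impI)
      fix W W' assume "W \<in> Q" "W' \<in> Q" "W \<noteq> W'"
      \<comment> \<open>A shared edge would lie in two disjoint classes, but edges have two
        vertices.\<close>
      then have "e = {}" if "e \<in> E W" "e \<in> E W'" for e
        using disj[of W W'] that by (auto simp: E_def)
      moreover have "{} \<notin> C"
        using two[of "{}"] by auto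
      ultimately show "E W \<inter> E W' = {}"
        by (auto simp: E_def)
    qed
  qed (use finQ finC in \<open>auto simp: E_def\<close>)
  moreover have "card (\<Union>W\<in>Q. E W) \<le> card C"
    using finC by (intro card_mono) (auto simp: E_def)
  ultimately show ?thesis
    by (simp add: sum_distrib_left[symmetric])
qed

section \<open>The kernelization\<close>

text \<open>The empty graph has the empty cover, so only a negative parameter makes it a
  no-instance. A negative \<open>k\<close> is kept because \<open>-1\<close> may exceed it.\<close>

fun kernel :: "nat graph \<times> int \<Rightarrow> nat graph \<times> int" where
  "kernel (G, k) =
     (if k < 0 then (({}, {}), k)
      else if 2 * int (card (fst G)) \<le> 3 * k then (G, k)
      else (({}, {}), -1))"

lemma Total_Edge_Cover_nonneg: "Total_Edge_Cover G k \<Longrightarrow> 0 \<le> k"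
  by (auto simp: Total_Edge_Cover_def)

lemma kernel_correct:
  assumes inst: "(G, k) \<in> graph_instances" and K: "kernel (G, k) = (G', k')"
  shows "(G', k') \<in> graph_instances" "Total_Edge_Cover G k \<longleftrightarrow> Total_Edge_Cover G' k'"
    "k' \<le> k" "real (card (fst G')) \<le> max 0 (1.5 * real_of_int k)"
proof -
  have empty: "(({}, {}), j) \<in> graph_instances" for j
    by (auto simp: graph_instances_def simple_graph_def intro: exI[of _ 0])
  show "(G', k') \<in> graph_instances"
    using K inst empty by (auto split: if_splits)
  show "k' \<le> k"
    using K by (auto split: if_splits)
  show "real (card (fst G')) \<le> max 0 (1.5 * real_of_int k)"
    using K by (auto split: if_splits)
  have "2 * int (card (fst G)) \<le> 3 * k" if "Total_Edge_Cover G k"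
  proof -
    from that obtain C where "total_edge_cover G C" "int (card C) \<le> k"
      by (auto simp: Total_Edge_Cover_def)
    moreover have "simple_graph G"
      using inst by (simp add: graph_instances_def)
    ultimately show ?thesis
      using total_edge_cover_card_vertices[of G C] by linarith
  qed
  then show "Total_Edge_Cover G k \<longleftrightarrow> Total_Edge_Cover G' k'"
    using K by (auto split: if_splits dest: Total_Edge_Cover_nonneg)
qed

section \<open>A Turing machine for the kernelization\<close>

text \<open>
  Tape 0 holds the instance. Tapes 1 and 2 carry the symbol 1 at position 0 and are blank
  elsewhere, and they serve as counters whose values are their head positions.

  \<^item> 0: branch on the sign of \<open>k\<close> and mark the origins of the counters.
  \<^item> 1, 2: skip the digits of \<open>k\<close>.
  \<^item> 3, 4: set the first counter to \<open>2 * n\<close>.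
  \<^item> 5, 6: return to the first digit.
  \<^item> 7 to 10: for each digit \<open>b\<close>, least significant first, subtract \<open>3 * b\<close> from the first counter;
    after the last digit, accept if it is zero.
  \<^item> 11, 12: halve the first counter into the second, rounding up.
  \<^item> 13: move the second counter back into the first.
  \<^item> 14, 15: erase tape 0.
  \<^item> 16 to 20: write the empty graph with parameter \<open>-1\<close>.
  \<^item> 21, 22: skip the digits of a negative \<open>k\<close>.
  \<^item> 23, 24: replace the graph by the empty graph.

  The components of the result are the new state, the symbol written to tape 0, and the three
  head moves. The arguments \<open>za\<close> and \<open>zb\<close> tell whether the counters are zero.
\<close>

definition kernel_program ::
  "nat \<Rightarrow> nat \<Rightarrow> bool \<Rightarrow> bool \<Rightarrow> nat \<times> nat \<times> move \<times> move \<times> move" where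
  "kernel_program q s za zb =
    (if q = 0 then (if s = 2 then 21 else 1, s, MoveRight, Stay, Stay)
     else if q = 1 then (if s = 2 then 2 else 3, s, MoveRight, Stay, Stay)
     else if q = 2 then (1, s, MoveRight, Stay, Stay)
     else if q = 3 then
       (if s = 2 then (4, s, Stay, MoveRight, Stay) else (5, s, Stay, Stay, Stay))
     else if q = 4 then (3, s, MoveRight, MoveRight, Stay)
     else if q = 5 then
       (if s = 0 then (6, s, MoveRight, Stay, Stay) else (5, s, MoveLeft, Stay, Stay))
     else if q = 6 then (7, s, MoveRight, Stay, Stay)
     else if q = 7 then
       (if s = 2 then (8, s, MoveRight, Stay, Stay)
        else (if za then 25 else 14, s, Stay, Stay, Stay))
     else if q = 8 then
       (if s = 2 then (9, s, Stay, MoveLeft, Stay) else (11, s, MoveRight, Stay, Stay))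
     else if q = 9 then (10, s, Stay, MoveLeft, Stay)
     else if q = 10 then (11, s, MoveRight, MoveLeft, Stay)
     else if q = 11 then
       (if za then (13, s, Stay, Stay, Stay) else (12, s, Stay, MoveLeft, MoveRight))
     else if q = 12 then (11, s, Stay, MoveLeft, Stay)
     else if q = 13 then
       (if zb then (7, s, Stay, Stay, Stay) else (13, s, Stay, MoveRight, MoveLeft))
     else if q = 14 then
       (if s = 0 then (15, s, MoveLeft, Stay, Stay) else (14, s, MoveRight, Stay, Stay))
     else if q = 15 then
       (if s = 0 then (16, s, MoveRight, Stay, Stay) else (15, 0, MoveLeft, Stay, Stay))
     else if q = 16 then (17, 2, MoveRight, Stay, Stay)
     else if q = 17 then (18, 2, MoveRight, Stay, Stay)
     else if q = 18 then (19, 2, MoveRight, Stay, Stay)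
     else if q = 19 then (20, 1, MoveRight, Stay, Stay)
     else if q = 20 then (25, 1, MoveRight, Stay, Stay)
     else if q = 21 then (if s = 2 then 22 else 23, s, MoveRight, Stay, Stay)
     else if q = 22 then (21, s, MoveRight, Stay, Stay)
     else if q = 23 then (24, 1, MoveRight, Stay, Stay)
     else if s = 0 then (25, s, Stay, Stay, Stay) else (24, 0, MoveRight, Stay, Stay))"

text \<open>Blocking left moves at the mark turns decrement into truncated subtraction, so that
  subtracting 3 from a smaller counter gives 0.\<close>

definition counter_move :: "nat \<Rightarrow> move \<Rightarrow> move" where
  "counter_move x m = (if x = 1 \<and> m = MoveLeft then Stay else m)"

definition kernel_tm :: tm where
  "kernel_tm = \<lparr>tapes = 3, states = 25, symbols = 3,
     delta = (\<lambda>q ss.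
       let (q', s, m, ma, mb) = kernel_program q (ss ! 0) (ss ! 1 = 1) (ss ! 2 = 1)
       in (q', [(s, m),
                (if q = 0 then 1 else ss ! 1, counter_move (ss ! 1) ma),
                (if q = 0 then 1 else ss ! 2, counter_move (ss ! 2) mb)]))\<rparr>"

lemma turing_machine_kernel_tm: "turing_machine kernel_tm"
proof -
  have "fst (kernel_program q s za zb) \<le> 25 \<and> fst (snd (kernel_program q s za zb)) < 3"
    if "s < 3" for q s za zb
    using that by (simp add: kernel_program_def)
  moreover have "ss ! i < 3" if "set ss \<subseteq> {..<3}" "length ss = 3" "i < 3" for ss :: "nat list" and i
    using that by (metis lessThan_iff nth_mem subsetD)
  ultimately show ?thesis
    by (simp add: turing_machine_def kernel_tm_def split: prod.split) (metis fst_conv snd_conv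
        One_nat_def lessI less_numeral_extra(3) numeral_3_eq_3 zero_less_Suc numeral_2_eq_2 Suc_less_eq)
qed

section \<open>Configurations with two counters\<close>

definition counter_tape :: "int \<Rightarrow> nat" where
  "counter_tape = (\<lambda>_. 0)(0 := 1)"

definition kernel_config :: "nat \<Rightarrow> (int \<Rightarrow> nat) \<Rightarrow> int \<Rightarrow> nat \<Rightarrow> nat \<Rightarrow> config" where
  "kernel_config q t h a b = (q, [(t, h), (counter_tape, int a), (counter_tape, int b)])"

fun counter_shift :: "move \<Rightarrow> nat \<Rightarrow> nat" where
  "counter_shift MoveLeft a = a - 1"
| "counter_shift Stay a = a"
| "counter_shift MoveRight a = a + 1"

lemma counter_tape_eq_1_iff: "counter_tape (int a) = Suc 0 \<longleftrightarrow> a = 0"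
  by (simp add: counter_tape_def)

lemma act_counter:
  "act (counter_tape (int a), counter_move (counter_tape (int a)) m) (counter_tape, int a) =
   (counter_tape, int (counter_shift m a))"
  by (cases m) (auto simp: counter_move_def counter_tape_eq_1_iff of_nat_diff)

text \<open>State 0 is excluded because it writes the origin marks, state 25 because it
  halts.\<close>

lemma step_kernel_config:
  assumes "0 < q" "q < 25" "kernel_program q (t h) (a = 0) (b = 0) = (q', s, m, ma, mb)"
  shows "step kernel_tm (kernel_config q t h a b) =
    kernel_config q' (t(h := s)) (shift m h) (counter_shift ma a) (counter_shift mb b)"
  using assms
  by (simp add: kernel_config_def kernel_tm_def counter_tape_eq_1_iff act_counter del: act.simps)
     simp

section \<open>Runs with a bound on the number of steps\<close>

definition reaches :: "config \<Rightarrow> nat \<Rightarrow> config \<Rightarrow> bool" where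
  "reaches c b c' \<longleftrightarrow> (\<exists>t\<le>b. (step kernel_tm ^^ t) c = c')"

lemma reaches_refl: "reaches c b c"
  unfolding reaches_def by (intro exI[of _ 0]) simp

lemma reaches_trans:
  assumes "reaches c b c'" "reaches c' b' c''"
  shows "reaches c (b + b') c''"
proof -
  from assms obtain t t' where "t \<le> b" "t' \<le> b'"
    "(step kernel_tm ^^ t) c = c'" "(step kernel_tm ^^ t') c' = c''"
    by (auto simp: reaches_def)
  then show ?thesis
    unfolding reaches_def by (intro exI[of _ "t' + t"]) (simp add: funpow_add)
qed

lemma reaches_mono: "reaches c b c' \<Longrightarrow> b \<le> b' \<Longrightarrow> reaches c b' c'"
  unfolding reaches_def using le_trans by blast

lemma reaches_step:
  assumes "step kernel_tm c = c'" "reaches c' b c''"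
  shows "reaches c (Suc b) c''"
proof -
  have "reaches c 1 c'"
    using assms(1) unfolding reaches_def by (intro exI[of _ 1]) simp
  from reaches_trans[OF this assms(2)] show ?thesis
    by simp
qed

text \<open>Symbolic execution: applied backwards, it performs one transition and leaves
  \<open>kernel_program\<close> to be evaluated by simplification. Time bounds are therefore written
  with explicit \<open>Suc\<close>.\<close>

lemma reaches_kernel_step:
  assumes "0 < q" "q < 25"
    "case kernel_program q (t h) (a = 0) (b = 0) of (q', s, m, ma, mb) \<Rightarrow>
      reaches (kernel_config q' (t(h := s)) (shift m h) (counter_shift ma a) (counter_shift mb b)) l c"
  shows "reaches (kernel_config q t h a b) (Suc l) c"
  using assms reaches_step step_kernel_config by (auto split: prod.splits)

section \<open>Codes of integers and tape contents\<close>

fun self_delimiting :: "bool list \<Rightarrow> bool list" where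
  "self_delimiting [] = [False]"
| "self_delimiting (b # bs) = True # b # self_delimiting bs"

lemma length_self_delimiting: "length (self_delimiting bs) = 2 * length bs + 1"
  by (induction bs) auto

text \<open>Recursive form of the digit code, suited to induction on the digits.\<close>

lemma encode_int_eq: "encode_int k = (k < 0) # self_delimiting (bits (nat \<bar>k\<bar>))"
proof -
  have "concat (map (\<lambda>b. [True, b]) bs) @ [False] = self_delimiting bs" for bs
    by (induction bs) auto
  then show ?thesis
    by (simp add: encode_int_def)
qed

lemma word_tape_middle:
  "h = int (length u) \<Longrightarrow> word_tape (u @ b # v) h = (if b then 2 else 1)"
  by (simp add: word_tape_def)

lemma word_tape_eq_0_iff: "word_tape w i = 0 \<longleftrightarrow> i < 0 \<or> int (length w) \<le> i"
  by (auto simp: word_tape_def)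

lemma word_tape_snoc:
  "(word_tape u)(int (length u) := (if b then 2 else 1)) = word_tape (u @ [b])"
  by (rule ext) (auto simp: word_tape_def nth_append)

lemma word_tape_erase_last: "(word_tape (u @ [b]))(int (length u) := 0) = word_tape u"
  by (rule ext) (auto simp: word_tape_def nth_append)

section \<open>Effect and running time of the single phases\<close>

text \<open>Both sign branches run the same loop. The scanned prefix \<open>u\<close> is arbitrary
  so that the induction can shift each marker-digit pair into it.\<close>

lemma skip_digits:
  assumes "(q, q', q'') = (1, 2, 3) \<or> (q, q', q'') = (21, 22, 23)" "h = int (length u)"
  shows "reaches (kernel_config q (word_tape (u @ self_delimiting bs @ v)) h a b)
    (2 * length bs + 1)
    (kernel_config q'' (word_tape (u @ self_delimiting bs @ v)) (h + int (2 * length bs + 1)) a b)"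
  using assms(2)
proof (induction bs arbitrary: u h)
  case Nil
  show ?case
    using assms(1)
    by (auto intro!: reaches_kernel_step reaches_refl
        simp: kernel_program_def fun_upd_idem word_tape_middle Nil)
next
  case (Cons x bs)
  let ?t = "word_tape (u @ self_delimiting (x # bs) @ v)"
  have "reaches (kernel_config q ?t (h + 1 + 1) a b) (2 * length bs + 1)
      (kernel_config q'' ?t (h + 2 + int (2 * length bs + 1)) a b)"
    using Cons.IH[of "h + 1 + 1" "u @ [True, x]"] Cons.prems by simp
  moreover have "?t h = 2"
    using Cons.prems by (simp add: word_tape_middle)
  ultimately have "reaches (kernel_config q ?t h a b) (Suc (Suc (2 * length bs + 1)))
      (kernel_config q'' ?t (h + 2 + int (2 * length bs + 1)) a b)"
    using assms(1) by (elim disjE; simp)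
      (rule reaches_kernel_step, simp, simp, simp add: kernel_program_def fun_upd_idem,
        rule reaches_kernel_step, simp, simp, simp add: kernel_program_def fun_upd_idem)+
  then show ?case
    by (simp add: algebra_simps)
qed

text \<open>Each \<open>True\<close> of the unary number contributes 2: state 3 increments in place,
  state 4 increments while moving on.\<close>

lemma count_vertices:
  assumes "h = int (length u)"
  shows "reaches (kernel_config 3 (word_tape (u @ replicate n True @ False # v)) h a b)
    (2 * n + 1)
    (kernel_config 5 (word_tape (u @ replicate n True @ False # v)) (h + int n) (a + 2 * n) b)"
  using assms
proof (induction n arbitrary: u h a)
  case 0
  then show ?case
    by (auto intro!: reaches_kernel_step reaches_refl simp: kernel_program_def fun_upd_idem word_tape_middle)
next
  case (Suc n)
  let ?t = "word_tape (u @ replicate (Suc n) True @ False # v)"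
  have "reaches (kernel_config 3 ?t (h + 1) (a + 2) b) (2 * n + 1)
      (kernel_config 5 ?t (h + 1 + int n) (a + 2 + 2 * n) b)"
    using Suc.IH[of "h + 1" "u @ [True]" "a + 2"] Suc.prems by simp
  moreover have "?t h = 2"
    using Suc.prems by (simp add: word_tape_middle)
  ultimately have "reaches (kernel_config 3 ?t h a b) (Suc (Suc (2 * n + 1)))
      (kernel_config 5 ?t (h + 1 + int n) (a + 2 + 2 * n) b)"
    by -
      (rule reaches_kernel_step, simp, simp, simp add: kernel_program_def fun_upd_idem,
        rule reaches_kernel_step, simp, simp, simp add: kernel_program_def fun_upd_idem)
  then show ?case
    by (simp add: algebra_simps)
qed

text \<open>The head runs onto the blank at position -1; two right moves then take it past the sign
  bit.\<close>

lemma rewind: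
  assumes "h < length w"
  shows "reaches (kernel_config 5 (word_tape w) (int h) a b) (h + 4)
    (kernel_config 7 (word_tape w) 1 a b)"
  using assms
proof (induction h)
  case 0
  have "reaches (kernel_config 5 (word_tape w) 0 a b) (Suc (Suc (Suc 0)))
    (kernel_config 7 (word_tape w) 1 a b)"
    using 0
    by (auto intro!: reaches_kernel_step reaches_refl
        simp: kernel_program_def fun_upd_idem word_tape_eq_0_iff)
  then show ?case
    by (auto intro: reaches_mono)
next
  case (Suc h)
  then have "reaches (kernel_config 5 (word_tape w) (int (Suc h)) a b) (Suc (h + 4))
    (kernel_config 7 (word_tape w) 1 a b)"
    by (intro reaches_kernel_step) (auto simp: kernel_program_def fun_upd_idem word_tape_eq_0_iff)
  then show ?case
    by simp
qed

text \<open>Each round removes two units from the first counter and adds one to the second. An odd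
  value ends with a round that removes a single unit, hence the rounding up.\<close>

lemma halve_counter:
  "reaches (kernel_config 11 t h a b) (2 * a + 1) (kernel_config 13 t h 0 (b + (a + 1) div 2))"
proof (induction a arbitrary: b rule: less_induct)
  case (less a)
  show ?case
  proof (cases "a = 0")
    case True
    then show ?thesis
      by (auto intro!: reaches_kernel_step reaches_refl simp: kernel_program_def fun_upd_idem)
  next
    case False
    then have "b + 1 + (a - 1 - 1 + 1) div 2 = b + (a + 1) div 2"
      by (cases "a = 1") auto
    moreover have "reaches (kernel_config 11 t h (a - 1 - 1) (b + 1)) (2 * (a - 1 - 1) + 1)
        (kernel_config 13 t h 0 (b + 1 + (a - 1 - 1 + 1) div 2))"
      using False by (intro less) auto
    ultimately have "reaches (kernel_config 11 t h (a - 1 - 1) (b + 1)) (2 * (a - 1 - 1) + 1)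
        (kernel_config 13 t h 0 (b + (a + 1) div 2))"
      by metis
    then have "reaches (kernel_config 11 t h a b) (Suc (Suc (2 * (a - 1 - 1) + 1)))
        (kernel_config 13 t h 0 (b + (a + 1) div 2))"
      using False by -
        (rule reaches_kernel_step, simp, simp, simp add: kernel_program_def fun_upd_idem,
        rule reaches_kernel_step, simp, simp, simp add: kernel_program_def fun_upd_idem)
    then show ?thesis
      using False by (elim reaches_mono) auto
  qed
qed

lemma move_counter_back:
  "reaches (kernel_config 13 t h a b) (b + 1) (kernel_config 7 t h (a + b) 0)"
proof (induction b arbitrary: a)
  case 0
  show ?case
    by (auto intro!: reaches_kernel_step reaches_refl simp: kernel_program_def fun_upd_idem)
next
  case (Suc b)
  from Suc[of "Suc a"] have "reaches (kernel_config 13 t h a (Suc b)) (Suc (b + 1))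
      (kernel_config 7 t h (a + Suc b) 0)"
    by -
      (rule reaches_kernel_step, simp, simp, simp add: kernel_program_def fun_upd_idem)
  then show ?case
    by simp
qed

text \<open>Value of the first counter once the digits are consumed; the truncated difference
  mirrors the blocked counter, and \<open>+ 1\<close> rounds the half up.\<close>

fun residue :: "nat \<Rightarrow> bool list \<Rightarrow> nat" where
  "residue m [] = m"
| "residue m (b # bs) = residue ((m - 3 * of_bool b + 1) div 2) bs"

text \<open>For a digit \<open>b\<close>, \<open>m \<le> 3 * (b + 2 * k)\<close> holds iff \<open>\<lceil>(m - 3 * b) / 2\<rceil> \<le> 3 * k\<close>.\<close>

lemma residue_bits_eq_0_iff: "residue m (bits k) = 0 \<longleftrightarrow> m \<le> 3 * k"
proof (induction k arbitrary: m rule: less_induct)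
  case (less k)
  show ?case
  proof (cases "k = 0")
    case True
    then show ?thesis
      by (simp add: bits.simps)
  next
    case False
    then have "residue m (bits k) = 0 \<longleftrightarrow> (m - 3 * of_bool (odd k) + 1) div 2 \<le> 3 * (k div 2)"
      using less[of "k div 2"] by (subst bits.simps) simp
    \<comment> \<open>For odd \<open>k\<close> the difference is truncated only if
      \<open>m < 3\<close>, where both sides hold.\<close>
    also have "\<dots> \<longleftrightarrow> m \<le> 3 * k"
      by (cases "odd k") (auto elim!: oddE evenE)
    finally show ?thesis .
  qed
qed

text \<open>Invariant: the second counter is zero at the start of each digit. Halving with rounding
  up never raises the first counter, so the bound \<open>N\<close> persists and every digit costs at
  most \<open>3 * N + 7\<close> steps.\<close>

lemma process_digits:
  assumes "h = int (length u)" "a \<le> N"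
  shows "reaches (kernel_config 7 (word_tape (u @ self_delimiting bs @ v)) h a 0)
    ((3 * N + 7) * length bs)
    (kernel_config 7 (word_tape (u @ self_delimiting bs @ v)) (h + int (2 * length bs))
      (residue a bs) 0)"
  using assms
proof (induction bs arbitrary: u h a)
  case Nil
  show ?case
    by (simp add: reaches_refl)
next
  case (Cons x bs)
  let ?t = "word_tape (u @ self_delimiting (x # bs) @ v)"
  let ?a = "a - 3 * of_bool x"
  have t: "?t h = 2" "?t (h + 1) = (if x then 2 else 1)"
    using Cons.prems word_tape_middle[of "h + 1" "u @ [True]"] by (simp_all add: word_tape_middle)
  \<comment> \<open>A digit \<open>True\<close> takes the four states 7 to 10, a digit
    \<open>False\<close> only 7 and 8.\<close>
  have "reaches (kernel_config 7 ?t h a 0) 4 (kernel_config 11 ?t (h + 2) ?a 0)"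
  proof (cases x)
    case True
    have "reaches (kernel_config 7 ?t h a 0) (Suc (Suc (Suc (Suc 0))))
        (kernel_config 11 ?t (h + 1 + 1) (a - 1 - 1 - 1) 0)"
      by (insert t True, (rule reaches_kernel_step, simp, simp, simp add: kernel_program_def fun_upd_idem
          reaches_refl add.commute)+)
    then show ?thesis
      using True by (simp add: numeral_eq_Suc add.assoc)
  next
    case False
    have "reaches (kernel_config 7 ?t h a 0) (Suc (Suc 0)) (kernel_config 11 ?t (h + 1 + 1) a 0)"
      by (insert t False, (rule reaches_kernel_step, simp, simp, simp add: kernel_program_def fun_upd_idem
          reaches_refl add.commute)+)
    then show ?thesis
      using False by (auto elim!: reaches_mono simp: add.assoc)
  qed
  from reaches_trans[OF reaches_trans[OF this halve_counter] move_counter_back]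
  have "reaches (kernel_config 7 ?t h a 0) (4 + (2 * ?a + 1) + ((?a + 1) div 2 + 1))
      (kernel_config 7 ?t (h + 2) ((?a + 1) div 2) 0)"
    by (simp only: add_0)
  then have "reaches (kernel_config 7 ?t h a 0) (3 * N + 7)
      (kernel_config 7 ?t (h + 2) ((?a + 1) div 2) 0)"
    by (rule reaches_mono) (use Cons.prems in auto)
  moreover have "reaches (kernel_config 7 ?t (h + 2) ((?a + 1) div 2) 0) ((3 * N + 7) * length bs)
      (kernel_config 7 ?t (h + 2 + int (2 * length bs)) (residue ((?a + 1) div 2) bs) 0)"
    using Cons.IH[of "h + 2" "u @ [True, x]" "(?a + 1) div 2"] Cons.prems by simp
  ultimately show ?case
    by (auto dest: reaches_trans simp: algebra_simps)
qed

lemma seek_end: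
  assumes "h + d = length w"
  shows "reaches (kernel_config 14 (word_tape w) (int h) a b) (d + 1)
    (kernel_config 15 (word_tape w) (int (length w) - 1) a b)"
  using assms
proof (induction d arbitrary: h)
  case 0
  then show ?case
    by (auto intro!: reaches_kernel_step reaches_refl
        simp: kernel_program_def fun_upd_idem word_tape_eq_0_iff)
next
  case (Suc d)
  have "reaches (kernel_config 14 (word_tape w) (int h + 1) a b) (d + 1)
    (kernel_config 15 (word_tape w) (int (length w) - 1) a b)"
    using Suc.IH[of "Suc h"] Suc.prems by (simp add: add.commute)
  then have "reaches (kernel_config 14 (word_tape w) (int h) a b) (Suc (d + 1))
    (kernel_config 15 (word_tape w) (int (length w) - 1) a b)"
    using Suc.prems by -
      (rule reaches_kernel_step, simp, simp, simp add: kernel_program_def fun_upd_idem word_tape_eq_0_iff)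
  then show ?case
    by simp
qed

text \<open>Reverse induction follows erasing from the right. For the empty word the head is on the
  blank at -1, and the last move puts it at 0.\<close>

lemma erase_word:
  "reaches (kernel_config 15 (word_tape w) (int (length w) - 1) a b) (length w + 1)
    (kernel_config 16 (word_tape []) 0 a b)"
proof (induction w rule: rev_induct)
  case Nil
  show ?case
    by (auto intro!: reaches_kernel_step reaches_refl
        simp: kernel_program_def fun_upd_idem word_tape_eq_0_iff)
next
  case (snoc x w)
  then have "reaches (kernel_config 15 (word_tape (w @ [x])) (int (length (w @ [x])) - 1) a b)
      (Suc (length w + 1)) (kernel_config 16 (word_tape []) 0 a b)"
    by -
      (rule reaches_kernel_step, simp, simp, simp add: kernel_program_def fun_upd_idem word_tape_eq_0_iff word_tape_erase_last)
  then show ?case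
    by simp
qed

text \<open>The word spells the sign bit of \<open>-1\<close>, its marked digit
  \<open>True, True\<close>, the terminator \<open>False\<close>, and \<open>False\<close> for the
  empty graph.\<close>

lemma write_no_instance:
  "\<exists>h. reaches (kernel_config 16 (word_tape []) 0 a b) 5
     (kernel_config 25 (word_tape [True, True, True, False, False]) h a b)"
proof -
  note snoc = word_tape_snoc[of "[]" True] word_tape_snoc[of "[True]" True]
    word_tape_snoc[of "[True, True]" True] word_tape_snoc[of "[True, True, True]" False]
    word_tape_snoc[of "[True, True, True, False]" False]
  have "reaches (kernel_config 16 (word_tape []) 0 a b) (Suc (Suc (Suc (Suc (Suc 0)))))
     (kernel_config 25 (word_tape [True, True, True, False, False]) 5 a b)"
    using snoc
    by (auto intro!: reaches_kernel_step reaches_refl simp: kernel_program_def fun_upd_idem)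
  then show ?thesis
    by (auto simp: numeral_eq_Suc)
qed

text \<open>The tape is arbitrary because erasing from the left leaves a gap, so intermediate
  contents need not be of the form \<open>word_tape w\<close>.\<close>

lemma erase_right:
  assumes "\<And>i. h \<le> i \<Longrightarrow> i < h + int d \<Longrightarrow> t i \<noteq> 0" "t (h + int d) = 0"
  shows "reaches (kernel_config 24 t h a b) (d + 1)
    (kernel_config 25 (\<lambda>i. if h \<le> i \<and> i < h + int d then 0 else t i) (h + int d) a b)"
  using assms
proof (induction d arbitrary: t h)
  case 0
  have "(\<lambda>i. if h \<le> i \<and> i < h + int 0 then 0 else t i) = t"
    by auto
  then show ?case
    using 0 by (auto intro!: reaches_kernel_step reaches_refl simp: kernel_program_def fun_upd_idem)
next
  case (Suc d)
  have "reaches (kernel_config 24 (t(h := 0)) (h + 1) a b) (d + 1)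
    (kernel_config 25 (\<lambda>i. if h + 1 \<le> i \<and> i < h + 1 + int d then 0 else (t(h := 0)) i)
      (h + 1 + int d) a b)"
    using Suc.prems by (intro Suc.IH) (auto simp: algebra_simps)
  moreover have "(\<lambda>i. if h + 1 \<le> i \<and> i < h + 1 + int d then 0 else (t(h := 0)) i) =
      (\<lambda>i. if h \<le> i \<and> i < h + int (Suc d) then 0 else t i)"
    by (auto simp: fun_eq_iff)
  moreover have "t h \<noteq> 0"
    using Suc.prems by auto
  ultimately have "reaches (kernel_config 24 t h a b) (Suc (d + 1))
      (kernel_config 25 (\<lambda>i. if h \<le> i \<and> i < h + int (Suc d) then 0 else t i)
        (h + 1 + int d) a b)"
    by -
      (rule reaches_kernel_step, simp, simp, simp add: kernel_program_def fun_upd_idem word_tape_eq_0_iff)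
  then show ?case
    by (simp add: algebra_simps)
qed

text \<open>The first cell of \<open>g\<close> receives the \<open>False\<close> that encodes the
  empty graph; the other cells of \<open>g\<close> are blanked.\<close>

lemma truncate_graph:
  assumes "g \<noteq> []"
  shows "\<exists>h. reaches (kernel_config 23 (word_tape (u @ g)) (int (length u)) a b) (length g + 1)
    (kernel_config 25 (word_tape (u @ [False])) h a b)"
proof -
  define h where "h = int (length u)"
  define d where "d = length g - 1"
  let ?t = "(word_tape (u @ g))(h := 1)"
  have d: "length g = Suc d"
    using assms by (simp add: d_def)
  have "reaches (kernel_config 24 ?t (h + 1) a b) (d + 1)
      (kernel_config 25 (\<lambda>i. if h + 1 \<le> i \<and> i < h + 1 + int d then 0 else ?t i)
        (h + 1 + int d) a b)"
    by (rule erase_right) (auto simp: word_tape_eq_0_iff d h_def)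
  moreover have "(\<lambda>i. if h + 1 \<le> i \<and> i < h + 1 + int d then 0 else ?t i) = word_tape (u @ [False])"
    by (rule ext) (auto simp: word_tape_def d h_def nth_append)
  ultimately have "reaches (kernel_config 24 ?t (h + 1) a b) (d + 1)
      (kernel_config 25 (word_tape (u @ [False])) (h + 1 + int d) a b)"
    by simp
  then have "reaches (kernel_config 23 (word_tape (u @ g)) h a b) (Suc (d + 1))
      (kernel_config 25 (word_tape (u @ [False])) (h + 1 + int d) a b)"
    by (intro reaches_kernel_step) (auto simp: kernel_program_def)
  then show ?thesis
    by (auto simp: d h_def)
qed

section \<open>Complete runs and the polynomial time bound\<close>

lemma step_initial:
  "step kernel_tm (initial kernel_tm (x # v)) =
     kernel_config (if x then 21 else 1) (word_tape (x # v)) 1 0 0"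
proof -
  have "word_tape (x # v) 0 = (if x then 2 else 1)"
    by (simp add: word_tape_def)
  then show ?thesis
    by (simp add: initial_def kernel_tm_def kernel_config_def counter_tape_def counter_move_def
        kernel_program_def numeral_2_eq_2 fun_upd_idem)
qed

lemma reaches_imp_outputs_within:
  assumes "reaches (initial kernel_tm x) l (kernel_config 25 (word_tape y) h a b)" "l \<le> l'"
  shows "outputs_within kernel_tm x y l'"
proof -
  obtain t where "t \<le> l" "(step kernel_tm ^^ t) (initial kernel_tm x) =
      (25, [(word_tape y, h), (counter_tape, int a), (counter_tape, int b)])"
    using assms(1) by (auto simp: reaches_def kernel_config_def)
  moreover have "states kernel_tm = 25"
    by (simp add: kernel_tm_def)
  ultimately show ?thesis
    unfolding outputs_within_def using assms(2) by (intro exI[of _ t]) auto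
qed

lemma kernel_tm_negative:
  assumes "w = True # self_delimiting bs @ g" "g \<noteq> []"
  shows "outputs_within kernel_tm w (True # self_delimiting bs @ [False]) (length w + 2)"
proof -
  have "reaches (kernel_config 21 (word_tape w) 1 0 0) (2 * length bs + 1)
      (kernel_config 23 (word_tape w) (1 + int (2 * length bs + 1)) 0 0)"
    using skip_digits[of 21 22 23 1 "[True]" bs g 0 0] assms(1) by simp
  moreover obtain h where
    "reaches (kernel_config 23 (word_tape w) (1 + int (2 * length bs + 1)) 0 0) (length g + 1)
      (kernel_config 25 (word_tape (True # self_delimiting bs @ [False])) h 0 0)"
    using truncate_graph[OF assms(2), of "True # self_delimiting bs" 0 0] assms(1)
    by (auto simp: length_self_delimiting)
  ultimately have "reaches (initial kernel_tm w) (Suc (2 * length bs + 1 + (length g + 1)))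
      (kernel_config 25 (word_tape (True # self_delimiting bs @ [False])) h 0 0)"
    by (intro reaches_step[OF _ reaches_trans]) (auto simp: assms(1) step_initial)
  then show ?thesis
    by (rule reaches_imp_outputs_within) (simp add: assms(1) length_self_delimiting)
qed

lemma kernel_tm_nonnegative:
  assumes w: "w = False # self_delimiting (bits k) @ replicate n True @ False # v"
  shows "outputs_within kernel_tm w
    (if 2 * n \<le> 3 * k then w else [True, True, True, False, False])
    (6 * (length w)\<^sup>2 + 20 * length w + 20)"
proof -
  define L where "L = length (bits k)"
  define N where "N = length w"
  define r where "r = residue (2 * n) (bits k)"
  let ?t = "word_tape w"
  have N: "N = 3 + 2 * L + n + length v"
    by (simp add: N_def w L_def length_self_delimiting)
  have 1: "reaches (kernel_config 1 ?t 1 0 0) (2 * L + 1) (kernel_config 3 ?t (int (2 * L + 2)) 0 0)"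
    using skip_digits[of 1 2 3 1 "[False]" "bits k" "replicate n True @ False # v" 0 0]
    by (simp add: w L_def)
  have 2: "reaches (kernel_config 3 ?t (int (2 * L + 2)) 0 0) (2 * n + 1)
      (kernel_config 5 ?t (int (2 * L + 2 + n)) (2 * n) 0)"
    using count_vertices[of "int (2 * L + 2)" "False # self_delimiting (bits k)" n v 0 0]
    by (simp add: w L_def length_self_delimiting ac_simps)
  have 3: "reaches (kernel_config 5 ?t (int (2 * L + 2 + n)) (2 * n) 0) (2 * L + 2 + n + 4)
      (kernel_config 7 ?t 1 (2 * n) 0)"
    using N by (intro rewind) (simp add: N_def)
  have 4: "reaches (kernel_config 7 ?t 1 (2 * n) 0) ((3 * (2 * n) + 7) * L)
      (kernel_config 7 ?t (int (2 * L + 1)) r 0)"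
    using process_digits[of 1 "[False]" "2 * n" "2 * n" "bits k" "replicate n True @ False # v"]
    by (simp add: w L_def r_def)
  \<comment> \<open>The cell behind the last digit holds the terminator, on which state 7 tests the
    counter for zero.\<close>
  have end_digits: "?t (int (2 * L + 1)) = 1"
  proof -
    have "self_delimiting bs ! (2 * length bs) = False" for bs
      by (induction bs) auto
    then show ?thesis
      by (simp add: word_tape_def w L_def nth_append length_self_delimiting nat_add_distrib nat_mult_distrib)
  qed
  \<comment> \<open>Accepting takes one step; rejecting erases the word and writes the no-instance.
    The bound covers both.\<close>
  have 5: "\<exists>h. reaches (kernel_config 7 ?t (int (2 * L + 1)) r 0) (2 * N + 10)
      (kernel_config 25 (word_tape (if 2 * n \<le> 3 * k then w else [True, True, True, False, False])) h r 0)"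
  proof (cases "2 * n \<le> 3 * k")
    case True
    then have "r = 0"
      by (simp add: r_def residue_bits_eq_0_iff)
    then have "reaches (kernel_config 7 ?t (int (2 * L + 1)) r 0) (Suc (2 * N + 9))
        (kernel_config 25 ?t (int (2 * L + 1)) r 0)"
      using end_digits
      by (intro reaches_kernel_step)
        (auto simp: kernel_program_def fun_upd_idem reaches_refl)
    then have "reaches (kernel_config 7 ?t (int (2 * L + 1)) r 0) (2 * N + 10)
        (kernel_config 25 ?t (int (2 * L + 1)) r 0)"
      by (rule reaches_mono) simp
    with True show ?thesis
      by auto
  next
    case False
    then have "r \<noteq> 0"
      by (simp add: r_def residue_bits_eq_0_iff)
    then have "reaches (kernel_config 7 ?t (int (2 * L + 1)) r 0) (Suc 0)
        (kernel_config 14 ?t (int (2 * L + 1)) r 0)"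
      using end_digits
      by (intro reaches_kernel_step)
        (auto simp: kernel_program_def fun_upd_idem reaches_refl)
    moreover have "reaches (kernel_config 14 ?t (int (2 * L + 1)) r 0) (N - (2 * L + 1) + 1)
        (kernel_config 15 ?t (int N - 1) r 0)"
      unfolding N_def by (rule seek_end) (use N in \<open>simp add: N_def\<close>)
    moreover have "reaches (kernel_config 15 ?t (int N - 1) r 0) (N + 1)
        (kernel_config 16 (word_tape []) 0 r 0)"
      unfolding N_def by (rule erase_word)
    moreover obtain h where "reaches (kernel_config 16 (word_tape []) 0 r 0) 5
        (kernel_config 25 (word_tape [True, True, True, False, False]) h r 0)"
      using write_no_instance by blast
    ultimately have "reaches (kernel_config 7 ?t (int (2 * L + 1)) r 0)
        (Suc 0 + (N - (2 * L + 1) + 1) + (N + 1) + 5)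
        (kernel_config 25 (word_tape [True, True, True, False, False]) h r 0)"
      by (blast intro: reaches_trans)
    then have "reaches (kernel_config 7 ?t (int (2 * L + 1)) r 0) (2 * N + 10)
        (kernel_config 25 (word_tape [True, True, True, False, False]) h r 0)"
      by (rule reaches_mono) simp
    with False show ?thesis
      by auto
  qed
  then obtain h where 5: "reaches (kernel_config 7 ?t (int (2 * L + 1)) r 0) (2 * N + 10)
      (kernel_config 25 (word_tape (if 2 * n \<le> 3 * k then w else [True, True, True, False, False])) h r 0)"
    by blast
  have "step kernel_tm (initial kernel_tm w) = kernel_config 1 ?t 1 0 0"
    unfolding w step_initial by simp
  from reaches_step[OF this reaches_trans[OF reaches_trans[OF reaches_trans[OF
          reaches_trans[OF 1 2] 3] 4] 5]]
  show ?thesis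
  proof (rule reaches_imp_outputs_within)
    \<comment> \<open>The digit loop dominates: \<open>L\<close> digits at a cost of
      \<open>6 * n + 7\<close> each, with \<open>L\<close> and \<open>n\<close> at most
      \<open>N\<close>. All other phases are linear in \<open>N\<close>.\<close>
    have "(3 * (2 * n) + 7) * L \<le> (6 * N + 7) * N"
      using N by (intro mult_mono) auto
    then show "Suc (2 * L + 1 + (2 * n + 1) + (2 * L + 2 + n + 4) + (3 * (2 * n) + 7) * L + (2 * N + 10))
        \<le> 6 * (length w)\<^sup>2 + 20 * length w + 20"
      unfolding N_def[symmetric] using N by (simp add: power2_eq_square algebra_simps)
  qed
qed

lemma polytime_kernel: "polytime_on graph_instances encode_instance kernel"
proof -
  have "outputs_within kernel_tm (encode_instance x) (encode_instance (kernel x))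
      (poly [:20, 20, 6:] (length (encode_instance x)))" if "x \<in> graph_instances" for x
  proof -
    obtain G k where x: "x = (G, k)"
      by (cases x)
    define n where "n = card (fst G)"
    define v where "v = concat (map (\<lambda>i. map (\<lambda>j. {i, j} \<in> snd G) [0..<n]) [0..<n])"
    define w where "w = encode_instance x"
    have w: "w = (k < 0) # self_delimiting (bits (nat \<bar>k\<bar>)) @ replicate n True @ False # v"
      by (simp add: w_def x encode_int_eq encode_graph_def n_def v_def Let_def)
    have empty: "encode_graph ({}, {}) = [False]"
      by (simp add: encode_graph_def)
    have bound: "poly [:20, 20, 6:] (length w) = 6 * (length w)\<^sup>2 + 20 * length w + 20"
      by (simp add: power2_eq_square algebra_simps)
    show ?thesis
    proof (cases "k < 0")
      case True
      have "outputs_within kernel_tm w (encode_instance (kernel x)) (length w + 2)"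
        using kernel_tm_negative[of w "bits (nat \<bar>k\<bar>)" "replicate n True @ False # v"] True
        by (simp add: w x encode_int_eq empty)
      then show ?thesis
        unfolding w_def[symmetric] bound outputs_within_def
        by (elim exE conjE, intro exI conjI) (auto elim: le_trans)
    next
      case False
      \<comment> \<open>Unfolding \<open>bits\<close> gives \<open>-1\<close> the single digit
        \<open>True\<close>, which matches the word written by the machine.\<close>
      have "encode_instance (kernel x) =
          (if 2 * n \<le> 3 * nat k then w else [True, True, True, False, False])"
        using False by (auto simp: w_def x n_def encode_int_eq empty bits.simps)
      then show ?thesis
        using kernel_tm_nonnegative[of w "nat k" n v] False w
        unfolding w_def[symmetric] bound by simp
    qed
  qed
  then show ?thesis
    unfolding polytime_on_def using turing_machine_kernel_tm by blast
qed

theorem theorem4: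
  shows "admits_vertex_kernel Total_Edge_Cover (\<lambda>k. max 0 (1.5 * real_of_int k))"
  unfolding admits_vertex_kernel_def using polytime_kernel kernel_correct by blast

end
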